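(* Suppose that $\ell=\ell(n)=O(n)$ (with $0\le\ell\le\binom n2$) and that $0\le m=m(n)\le\binom n2$. Then, with $p=p(n)=m(n)/\binom n2$, as $n\to\infty$, \[ q(\ell;n,m)\sim (1-p/2)^\ell \exp\left(-\Bigl(\frac{\ell}{n}\Bigr)^2\frac{p(1-p)}{(2-p)^2}\right). \] Furthermore, for any $\ell,n,m$ (with $n\ge 2$, $0\le \ell\le\binom n2$, $0\le m\le\binom n2$, $p=m/\binom n2$), we have $q(\ell;n,m)\le q'(\ell;n,p)=(1-p/2)^\ell$.
   Context: For $0\le m\le \binom n2$, $G(n,m)$ is the random graph with $n$ labelled vertices and $m$ edges, uniformly chosen among all such graphs; $G(n,p)$ is the random graph on $n$ labelled vertices in which each possible edge is present independently with probability $p$. $\vec G(n,m)$ and $\vec G(n,p)$ are the random directed graphs obtained from $G(n,m)$ and $G(n,p)$, respectively, by giving each edge one of its two orientations with probability $1/2$ each, independently of everything else. For $0\le\ell\le\binom n2$, fix $\ell$ distinct edges of the complete graph $K_n$ and give each of them an orientation. $q(\ell;n,m)$ is the probability that none of these $\ell$ directed edges appears in $\vec G(n,m)$, and $q'(\ell;n,p)$ is the corresponding probability in $\vec G(n,p)$. (By symmetry these do not depend on the choice of edges and orientations.) The relation $x_n\sim y_n$ means $x_n/y_n\to1$. *)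

theory Defs
  imports "HOL-Probability.Probability" "HOL-Library.Landau_Symbols"
begin

text \<open>A graph on the \<open>n\<close> labelled vertices \<open>{..<n}\<close> is given by its edge set, a set of
  two-element sets; a directed graph by its set of ordered pairs.\<close>

definition K_edges :: "nat \<Rightarrow> nat set set" where
  "K_edges n = {e. e \<subseteq> {..<n} \<and> card e = 2}"

definition Gnm :: "nat \<Rightarrow> nat \<Rightarrow> nat set set pmf" where
  "Gnm n m = pmf_of_set {E. E \<subseteq> K_edges n \<and> card E = m}"

definition Gnp :: "nat \<Rightarrow> real \<Rightarrow> nat set set pmf" where
  "Gnp n p = map_pmf (\<lambda>present. {e \<in> K_edges n. present e})
     (Pi_pmf (K_edges n) False (\<lambda>_. bernoulli_pmf p))"

definition undirected :: "'a \<times> 'a \<Rightarrow> 'a set" where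
  "undirected a = {fst a, snd a}"

text \<open>For an edge \<open>e = {u, v}\<close> with \<open>u \<noteq> v\<close>, the set \<open>{a. undirected a = e}\<close> consists of
  exactly the two orientations \<open>(u, v)\<close> and \<open>(v, u)\<close>.\<close>

definition random_orientation :: "'a set set \<Rightarrow> ('a \<times> 'a) set pmf" where
  "random_orientation E = map_pmf (\<lambda>orient. orient ` E)
     (Pi_pmf E undefined (\<lambda>e. pmf_of_set {a. undirected a = e}))"

definition dGnm :: "nat \<Rightarrow> nat \<Rightarrow> (nat \<times> nat) set pmf" where
  "dGnm n m = bind_pmf (Gnm n m) random_orientation"

definition dGnp :: "nat \<Rightarrow> real \<Rightarrow> (nat \<times> nat) set pmf" where
  "dGnp n p = bind_pmf (Gnp n p) random_orientation"

text \<open>\<open>D\<close> consists of \<open>l\<close> distinct edges of the complete graph, each with one orientation;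
  injectivity excludes that both orientations of the same edge are in \<open>D\<close>.\<close>

definition oriented_edges :: "nat \<Rightarrow> nat \<Rightarrow> (nat \<times> nat) set \<Rightarrow> bool" where
  "oriented_edges n l D \<longleftrightarrow>
     undirected ` D \<subseteq> K_edges n \<and> inj_on undirected D \<and> card D = l"

text \<open>The probabilities \<open>q(l; n, m)\<close> and \<open>q'(l; n, p)\<close>. They take the chosen set \<open>D\<close> of \<open>l\<close>
  oriented edges as an argument in place of \<open>l\<close>, and results are to be stated for every
  choice of \<open>D\<close>.\<close>

definition q :: "(nat \<times> nat) set \<Rightarrow> nat \<Rightarrow> nat \<Rightarrow> real" where
  "q D n m = measure_pmf.prob (dGnm n m) {A. D \<inter> A = {}}"

definition q' :: "(nat \<times> nat) set \<Rightarrow> nat \<Rightarrow> real \<Rightarrow> real" where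
  "q' D n p = measure_pmf.prob (dGnp n p) {A. D \<inter> A = {}}"

definition edge_density :: "nat \<Rightarrow> nat \<Rightarrow> real" where
  "edge_density n m = real m / real (n choose 2)"

end

theory Submission imports Defs "HOL-Real_Asymp.Real_Asymp" begin

text \<open>
  Write \<open>N\<close> for the number of edges of the complete graph and \<open>F\<close> for the set of the \<open>l\<close> edges that
  carry a prescribed orientation. Given the undirected graph \<open>E\<close>, each edge of \<open>E \<inter> F\<close> independently
  gets the other orientation with probability \<open>1/2\<close>, so the conditional probability of avoiding \<open>D\<close>
  is \<open>(1/2) ^ card (E \<inter> F)\<close>. Hence the binomial model gives exactly \<open>(1 - p/2) ^ l\<close>, and in the
  uniform model \<open>q\<close> is the average of that weight over all \<open>m\<close>-subsets \<open>E\<close>.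

  This average depends only on \<open>l\<close>, so call it \<open>q\<^sub>l\<close>, and expose the directed edges one at a time.
  Put \<open>q\<^sub>l\<^sub>+\<^sub>1 = q\<^sub>l (1 - \<pi>\<^sub>l / 2)\<close>; then \<open>\<pi>\<^sub>l\<close> is the conditional probability that a further edge is
  present in the graph, given that the first \<open>l\<close> directed edges are absent, and \<open>\<pi>\<^sub>0 = p\<close>. Under the
  same condition each of the \<open>l\<close> exposed edges is present with probability \<open>g(\<pi>\<^sub>l\<^sub>-\<^sub>1)\<close>, where
  \<open>g x = x / (2 - x)\<close>, by Bayes' rule. Since exactly \<open>m\<close> edges are present in total, this yields the
  recurrence

  \<open>(N - l) \<pi>\<^sub>l + l g(\<pi>\<^sub>l\<^sub>-\<^sub>1) = m = N p\<close>,

  so that \<open>(N - l) (\<pi>\<^sub>l - p) = l (p - g(\<pi>\<^sub>l\<^sub>-\<^sub>1))\<close>. One use of it shows \<open>\<pi>\<^sub>l = p + O(l/N)\<close>; as \<open>g\<close> is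
  Lipschitz, a second use shows \<open>\<pi>\<^sub>l = p + (l/N) (p - g p) + O(l\<^sup>2/N\<^sup>2)\<close> uniformly in \<open>p\<close>
  (\<open>next_prob_deviation\<close>). Here \<open>p - g p = p (1 - p) / (2 - p)\<close>. Taking logarithms of
  \<open>q\<^sub>l / (1 - p/2) ^ l = (\<Prod>i<l. (1 - \<pi>\<^sub>i/2) / (1 - p/2))\<close> and summing, the main term is
  \<open>- (l\<^sup>2 / (2 N)) p (1 - p) / (2 - p)\<^sup>2\<close>, and \<open>2 N\<close> is asymptotically \<open>n\<^sup>2\<close>. For \<open>l = O(n)\<close> the error is
  \<open>O(l\<^sup>3/N\<^sup>2 + 1/n) = O(1/n)\<close>; \<open>ln_q_bound\<close> gives it explicitly.

  For the inequality it suffices that \<open>\<pi>\<^sub>l \<ge> p\<close>. The weight \<open>(1/2) ^ card (E \<inter> F)\<close> decreases as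
  \<open>card (E \<inter> F)\<close> grows, so by Chebyshev's sum inequality the weighted mean of \<open>card (E \<inter> F)\<close> is at
  most its unweighted mean \<open>l p\<close>. The \<open>N - l\<close> unexposed edges therefore carry a weighted mean of at
  least \<open>(N - l) p\<close> (\<open>std_avoid_weight_Suc_le_density\<close>).
\<close>

section \<open>Weighted counting of sets of fixed size\<close>

definition avoid_weight :: "'a set \<Rightarrow> nat \<Rightarrow> 'a set \<Rightarrow> real" where
  "avoid_weight K m F = (\<Sum>E | E \<subseteq> K \<and> card E = m. (1/2) ^ card (E \<inter> F))"

lemma finite_subsets_of_card:
  assumes "finite K"
  shows "finite {E. E \<subseteq> K \<and> card E = m}"
  using assms by (rule finite_subset[rotated, OF finite_Pow_iff[THEN iffD2]]) auto

text \<open>Marking the size of \<open>E\<close> by a formal variable \<open>x\<close> turns the sum over all \<open>E\<close> into the product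
  \<open>\<Prod>e\<in>K. 1 + w e * x\<close>, in which \<open>w e\<close> is \<open>1/2\<close> on \<open>F\<close> and \<open>1\<close> elsewhere; the factors depend on \<open>e\<close> only
  through membership in \<open>F\<close>.\<close>
lemma avoid_weight_eq_coeff:
  assumes K: "finite K" and F: "F \<subseteq> K"
  shows "avoid_weight K m F =
    poly.coeff ((monom (1/2) 1 + 1) ^ card F * (monom 1 1 + 1) ^ (card K - card F)) m"
proof -
  define w where "w e = (if e \<in> F then 1/2 else 1 :: real)" for e
  have prod_w: "(\<Prod>e\<in>E. w e) = (1/2) ^ card (E \<inter> F)" if "E \<subseteq> K" for E
  proof -
    have "finite E" using that K finite_subset by blast
    then show ?thesis
      by (simp add: w_def prod.If_cases prod_constant)
  qed
  have prod_monom: "(\<Prod>e\<in>E. monom (w e) (Suc 0)) = monom (\<Prod>e\<in>E. w e) (card E)" if "finite E" for E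
    using that by (induction E) (simp_all add: mult_monom)
  have fK: "finite E" if "E \<subseteq> K" for E using that K finite_subset by blast
  have "(\<Prod>e\<in>K. monom (w e) 1 + 1) =
        (\<Prod>e\<in>K - F. monom (w e) 1 + 1) * (\<Prod>e\<in>F. monom (w e) 1 + 1)"
    using K F by (rule prod.subset_diff[rotated])
  also have "(\<Prod>e\<in>F. monom (w e) 1 + 1) = (monom (1/2) 1 + 1) ^ card F"
    by (simp add: w_def)
  also have "(\<Prod>e\<in>K - F. monom (w e) 1 + 1) = (monom 1 1 + 1) ^ (card K - card F)"
    using fK[OF F] F by (simp add: w_def card_Diff_subset)
  finally have "poly.coeff ((monom (1/2) 1 + 1) ^ card F * (monom 1 1 + 1) ^ (card K - card F)) m
     = poly.coeff (\<Prod>e\<in>K. monom (w e) 1 + 1) m"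
    by (simp only: mult.commute)
  also have "\<dots> = (\<Sum>E\<in>Pow K. poly.coeff (monom (\<Prod>e\<in>E. w e) (card E)) m)"
    unfolding prod_add[OF K] coeff_sum
    by (intro sum.cong refl) (simp add: prod_monom[OF fK] del: coeff_monom)
  also have "\<dots> = (\<Sum>E\<in>Pow K. if card E = m then (1/2) ^ card (E \<inter> F) else 0)"
    by (intro sum.cong) (auto simp: prod_w)
  also have "\<dots> = avoid_weight K m F"
    unfolding avoid_weight_def using K
    by (subst sum.inter_filter[symmetric]) (auto intro!: sum.cong)
  finally show ?thesis by simp
qed

corollary avoid_weight_depends_on_cards:
  assumes "finite K" "F \<subseteq> K" "finite K'" "F' \<subseteq> K'" "card K = card K'" "card F = card F'"
  shows "avoid_weight K m F = avoid_weight K' m F'"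
  using assms by (simp add: avoid_weight_eq_coeff)

lemma avoid_weight_empty:
  assumes "finite K"
  shows "avoid_weight K m {} = real (card K choose m)"
  using assms by (simp add: avoid_weight_def n_subsets)

lemma avoid_weight_pos:
  assumes "finite K" "m \<le> card K"
  shows "avoid_weight K m F > 0"
proof -
  obtain E where "E \<subseteq> K" "card E = m" using obtain_subset_with_card_n[OF assms(2)] by metis
  then show ?thesis
    unfolding avoid_weight_def using finite_subsets_of_card[OF assms(1)]
    by (intro sum_pos) auto
qed

text \<open>Adding \<open>e\<close> to \<open>F\<close> halves the weight of exactly those \<open>E\<close> that contain \<open>e\<close>. Together with the
  next lemma this expresses the weight of the sets through a given edge by differences of
  \<open>avoid_weight\<close>, whether or not the edge lies in \<open>F\<close>.\<close>
lemma avoid_weight_insert: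
  assumes K: "finite K" and e: "e \<in> K" "e \<notin> F"
  shows "2 * (avoid_weight K m F - avoid_weight K m (insert e F)) =
    (\<Sum>E | E \<subseteq> K \<and> card E = m. of_bool (e \<in> E) * (1/2) ^ card (E \<inter> F))"
  unfolding avoid_weight_def sum_subtractf[symmetric] sum_distrib_left
proof (intro sum.cong refl)
  fix E assume "E \<in> {E. E \<subseteq> K \<and> card E = m}"
  then have "finite E" using K finite_subset by blast
  show "2 * ((1/2) ^ card (E \<inter> F) - (1/2) ^ card (E \<inter> insert e F)) =
    of_bool (e \<in> E) * (1/2 :: real) ^ card (E \<inter> F)"
  proof (cases "e \<in> E")
    case True
    then have "card (E \<inter> insert e F) = Suc (card (E \<inter> F))"
      using \<open>finite E\<close> e by simp
    with True show ?thesis by simp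
  qed simp
qed

lemma avoid_weight_remove:
  assumes K: "finite K" and F: "F \<subseteq> K" and f: "f \<in> F"
  shows "avoid_weight K m (F - {f}) - avoid_weight K m F =
    (\<Sum>E | E \<subseteq> K \<and> card E = m. of_bool (f \<in> E) * (1/2) ^ card (E \<inter> F))"
  unfolding avoid_weight_def sum_subtractf[symmetric]
proof (intro sum.cong refl)
  fix E assume "E \<in> {E. E \<subseteq> K \<and> card E = m}"
  then have "finite E" using K finite_subset by blast
  show "(1/2) ^ card (E \<inter> (F - {f})) - (1/2) ^ card (E \<inter> F) =
    of_bool (f \<in> E) * (1/2 :: real) ^ card (E \<inter> F)"
  proof (cases "f \<in> E")
    case True
    then have "card (E \<inter> F) = Suc (card (E \<inter> (F - {f})))"
      using \<open>finite E\<close> f card_Suc_Diff1[of "E \<inter> F" f] by (simp add: Int_Diff)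
    with True show ?thesis by simp
  next
    case False
    then have "E \<inter> (F - {f}) = E \<inter> F" by auto
    with False show ?thesis by simp
  qed
qed

lemma sum_incidence:
  fixes h :: "'a set \<Rightarrow> real"
  assumes "finite A"
  shows "(\<Sum>e\<in>A. \<Sum>E\<in>M. of_bool (e \<in> E) * h E) = (\<Sum>E\<in>M. h E * card (E \<inter> A))"
proof -
  have "(\<Sum>e\<in>A. \<Sum>E\<in>M. of_bool (e \<in> E) * h E) = (\<Sum>E\<in>M. \<Sum>e\<in>A. of_bool (e \<in> E) * h E)"
    by (rule sum.swap)
  also have "\<dots> = (\<Sum>E\<in>M. h E * card (E \<inter> A))"
  proof (intro sum.cong refl)
    fix E
    have "(\<Sum>e\<in>A. of_bool (e \<in> E) * h E) = h E * (\<Sum>e\<in>A. of_bool (e \<in> E))"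
      by (simp add: sum_distrib_left mult.commute)
    then show "(\<Sum>e\<in>A. of_bool (e \<in> E) * h E) = h E * card (E \<inter> A)"
      using assms by (simp add: sum_of_bool_eq Int_commute Int_def)
  qed
  finally show ?thesis .
qed

text \<open>By symmetry one representative pair \<open>F \<subseteq> K\<close> for each pair of cardinalities suffices, which
  makes the weight a function of numbers.\<close>
definition std_avoid_weight :: "nat \<Rightarrow> nat \<Rightarrow> nat \<Rightarrow> real" where
  "std_avoid_weight N m l = avoid_weight {..<N} m {..<l}"

lemma avoid_weight_eq_std:
  assumes "finite K" "F \<subseteq> K"
  shows "avoid_weight K m F = std_avoid_weight (card K) m (card F)"
  unfolding std_avoid_weight_def
  by (rule avoid_weight_depends_on_cards) (use assms in \<open>auto intro: card_mono\<close>)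

lemma std_avoid_weight_0: "std_avoid_weight N m 0 = real (N choose m)"
  by (simp add: std_avoid_weight_def avoid_weight_empty)

lemma std_avoid_weight_pos: "m \<le> N \<Longrightarrow> std_avoid_weight N m l > 0"
  by (simp add: std_avoid_weight_def avoid_weight_pos)

lemma std_avoid_weight_diff:
  assumes "l \<le> N"
  shows "real l * (std_avoid_weight N m (l - 1) - std_avoid_weight N m l) =
    (\<Sum>E | E \<subseteq> {..<N} \<and> card E = m. (1/2) ^ card (E \<inter> {..<l}) * card (E \<inter> {..<l}))"
proof -
  have "real l * (std_avoid_weight N m (l - 1) - std_avoid_weight N m l) =
    (\<Sum>f<l. avoid_weight {..<N} m ({..<l} - {f}) - avoid_weight {..<N} m {..<l})"
  proof -
    have "avoid_weight {..<N} m ({..<l} - {f}) = std_avoid_weight N m (l - 1)" if "f < l" for f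
      using that assms by (subst avoid_weight_eq_std) auto
    then show ?thesis by (simp add: std_avoid_weight_def)
  qed
  also have "\<dots> = (\<Sum>f<l. \<Sum>E | E \<subseteq> {..<N} \<and> card E = m.
      of_bool (f \<in> E) * (1/2) ^ card (E \<inter> {..<l}))"
    using assms by (intro sum.cong refl avoid_weight_remove) auto
  also have "\<dots> = (\<Sum>E | E \<subseteq> {..<N} \<and> card E = m. (1/2) ^ card (E \<inter> {..<l}) * card (E \<inter> {..<l}))"
    by (rule sum_incidence) simp
  finally show ?thesis .
qed

lemma std_avoid_weight_step:
  assumes "l < N"
  shows "2 * (real N - real l) * (std_avoid_weight N m l - std_avoid_weight N m (Suc l)) =
    (\<Sum>E | E \<subseteq> {..<N} \<and> card E = m. (1/2) ^ card (E \<inter> {..<l}) * card (E \<inter> {l..<N}))"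
proof -
  have "2 * (real N - real l) * (std_avoid_weight N m l - std_avoid_weight N m (Suc l)) =
    (\<Sum>e=l..<N. 2 * (avoid_weight {..<N} m {..<l} - avoid_weight {..<N} m (insert e {..<l})))"
  proof -
    have "avoid_weight {..<N} m (insert e {..<l}) = std_avoid_weight N m (Suc l)"
      if "l \<le> e" "e < N" for e
      using that by (subst avoid_weight_eq_std) auto
    then show ?thesis using assms by (simp add: std_avoid_weight_def of_nat_diff algebra_simps)
  qed
  also have "\<dots> = (\<Sum>e=l..<N. \<Sum>E | E \<subseteq> {..<N} \<and> card E = m.
      of_bool (e \<in> E) * (1/2) ^ card (E \<inter> {..<l}))"
    by (intro sum.cong refl avoid_weight_insert) auto
  also have "\<dots> = (\<Sum>E | E \<subseteq> {..<N} \<and> card E = m. (1/2) ^ card (E \<inter> {..<l}) * card (E \<inter> {l..<N}))"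
    by (rule sum_incidence) simp
  finally show ?thesis .
qed

text \<open>The weighted number of incidences \<open>e \<in> E\<close> is counted in two ways: every \<open>E\<close> has \<open>m\<close> elements,
  and each of the \<open>l\<close> edges in \<open>F\<close> and of the \<open>N - l\<close> others contributes the corresponding difference.
  For \<open>l = 0\<close> the truncated \<open>l - 1\<close> is harmless, since its term has the factor \<open>l\<close>.\<close>
lemma std_avoid_weight_recurrence:
  assumes "l < N"
  shows "2 * (real N - real l) * (std_avoid_weight N m l - std_avoid_weight N m (Suc l))
     + real l * (std_avoid_weight N m (l - 1) - std_avoid_weight N m l) = m * std_avoid_weight N m l"
proof -
  have split: "card (E \<inter> {l..<N}) + card (E \<inter> {..<l}) = card E" if "E \<subseteq> {..<N}" for E
  proof -
    have "E = (E \<inter> {l..<N}) \<union> (E \<inter> {..<l})" using that by auto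
    then have "card E = card ((E \<inter> {l..<N}) \<union> (E \<inter> {..<l}))" by simp
    also have "\<dots> = card (E \<inter> {l..<N}) + card (E \<inter> {..<l})"
      by (rule card_Un_disjoint) auto
    finally show ?thesis by simp
  qed
  have "2 * (real N - real l) * (std_avoid_weight N m l - std_avoid_weight N m (Suc l))
     + real l * (std_avoid_weight N m (l - 1) - std_avoid_weight N m l) =
    (\<Sum>E | E \<subseteq> {..<N} \<and> card E = m. (1/2) ^ card (E \<inter> {..<l}) * m)"
    unfolding std_avoid_weight_step[OF assms] std_avoid_weight_diff[OF less_imp_le[OF assms]] sum.distrib[symmetric]
  proof (intro sum.cong refl)
    fix E assume "E \<in> {E. E \<subseteq> {..<N} \<and> card E = m}"
    then have "real m = real (card (E \<inter> {l..<N})) + real (card (E \<inter> {..<l}))"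
      using split[of E] by (simp flip: of_nat_add)
    then show "(1/2) ^ card (E \<inter> {..<l}) * real (card (E \<inter> {l..<N})) +
        (1/2) ^ card (E \<inter> {..<l}) * real (card (E \<inter> {..<l})) = (1/2) ^ card (E \<inter> {..<l}) * m"
      by (simp add: distrib_left)
  qed
  also have "\<dots> = m * std_avoid_weight N m l"
    by (simp add: std_avoid_weight_def avoid_weight_def sum_distrib_left mult.commute)
  finally show ?thesis using assms by (simp add: of_nat_diff)
qed

lemma std_avoid_weight_Suc_le:
  assumes "l < N"
  shows "std_avoid_weight N m (Suc l) \<le> std_avoid_weight N m l"
proof -
  have "0 \<le> 2 * (real N - real l) * (std_avoid_weight N m l - std_avoid_weight N m (Suc l))"
    using std_avoid_weight_step[OF assms, of m] assms
    by (auto simp: of_nat_diff intro!: sum_nonneg)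
  then show ?thesis using assms by (simp add: zero_le_mult_iff)
qed

lemma std_avoid_weight_Suc_ge: "std_avoid_weight N m l / 2 \<le> std_avoid_weight N m (Suc l)"
  unfolding std_avoid_weight_def avoid_weight_def sum_divide_distrib
proof (intro sum_mono)
  fix E assume "E \<in> {E. E \<subseteq> {..<N} \<and> card E = m}"
  then have "finite E" using finite_subset by blast
  then have "card (E \<inter> {..<Suc l}) \<le> Suc (card (E \<inter> {..<l}))"
    by (cases "l \<in> E") (simp_all add: lessThan_Suc)
  then have "(1/2 :: real) ^ Suc (card (E \<inter> {..<l})) \<le> (1/2) ^ card (E \<inter> {..<Suc l})"
    by (intro power_decreasing) auto
  then show "(1/2 :: real) ^ card (E \<inter> {..<l}) / 2 \<le> (1/2) ^ card (E \<inter> {..<Suc l})"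
    by simp
qed

section \<open>Avoidance probabilities as weighted counts\<close>

lemma measure_bind_pmf_expectation:
  "measure_pmf.prob (bind_pmf M f) A = measure_pmf.expectation M (\<lambda>x. measure_pmf.prob (f x) A)"
proof -
  have "ennreal (measure_pmf.prob (bind_pmf M f) A) = (\<integral>\<^sup>+x. measure_pmf.prob (f x) A \<partial>M)"
    by (simp add: measure_pmf.emeasure_eq_measure[symmetric])
  also have "\<dots> = ennreal (measure_pmf.expectation M (\<lambda>x. measure_pmf.prob (f x) A))"
    by (intro nn_integral_eq_integral measure_pmf.integrable_const_bound[where B = 1]) auto
  finally show ?thesis by (simp add: integral_nonneg_AE)
qed

lemma orientations_of_edge:
  assumes "u \<noteq> v"
  shows "{a. undirected a = {u, v}} = {(u, v), (v, u)}"
  using assms by (auto simp: undirected_def doubleton_eq_iff)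

lemma finite_K_edges: "finite (K_edges n)"
  by (rule finite_subset[of _ "Pow {..<n}"]) (auto simp: K_edges_def)

lemma card_K_edges: "card (K_edges n) = n choose 2"
  by (simp add: K_edges_def n_subsets)

lemma prob_orientation_avoids:
  assumes e: "e \<in> K_edges n" and D: "inj_on undirected D"
  shows "measure_pmf.prob (pmf_of_set {a. undirected a = e}) (- D) =
    (if e \<in> undirected ` D then 1/2 else 1)"
proof -
  obtain u v where uv: "e = {u, v}" "u \<noteq> v"
    using e by (auto simp: K_edges_def card_2_iff)
  have *: "{a. undirected a = e} = {(u, v), (v, u)}"
    using uv orientations_of_edge by simp
  have und: "undirected (u, v) = e" "undirected (v, u) = e"
    using uv by (auto simp: undirected_def)
  have avoid: "card ({(u, v), (v, u)} \<inter> - D) = (if e \<in> undirected ` D then 1 else 2)"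
  proof (cases "e \<in> undirected ` D")
    case True
    then obtain a where a: "a \<in> D" "undirected a = e" by auto
    then have "a = (u, v) \<or> a = (v, u)" using * by auto
    moreover have "\<not> ((u, v) \<in> D \<and> (v, u) \<in> D)"
      using inj_onD[OF D, of "(u, v)" "(v, u)"] und uv by auto
    ultimately have "{(u, v), (v, u)} \<inter> - D = {(u, v)} \<or> {(u, v), (v, u)} \<inter> - D = {(v, u)}"
      using a(1) by auto
    then have "card ({(u, v), (v, u)} \<inter> - D) = 1"
      unfolding One_nat_def card_1_singleton_iff by blast
    then show ?thesis using True by (simp only: if_True)
  next
    case False
    then have "(u, v) \<notin> D" "(v, u) \<notin> D"
      using und by (metis image_eqI)+
    then have "{(u, v), (v, u)} \<inter> - D = {(u, v), (v, u)}"
      by blast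
    then have "card ({(u, v), (v, u)} \<inter> - D) = 2"
      by (rule ssubst) (use uv in simp)
    then show ?thesis using False by (simp only: if_False)
  qed
  have prob: "measure_pmf.prob (pmf_of_set {(u, v), (v, u)}) (- D) =
      card ({(u, v), (v, u)} \<inter> - D) / card {(u, v), (v, u)}"
    by (rule measure_pmf_of_set) auto
  have "card {(u, v), (v, u)} = 2" using uv(2) by simp
  then show ?thesis
    unfolding * prob avoid by (simp only: split: if_split) simp
qed

text \<open>Avoiding \<open>D\<close> constrains each edge of \<open>E\<close> separately, and only the edges of \<open>E\<close> that underlie an
  element of \<open>D\<close> are constrained at all; injectivity leaves each of these one of two orientations.\<close>
lemma prob_random_orientation_avoids:
  assumes E: "E \<subseteq> K_edges n" and D: "inj_on undirected D"
  shows "measure_pmf.prob (random_orientation E) {A. D \<inter> A = {}} =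
    (1/2) ^ card (E \<inter> undirected ` D)"
proof -
  have fin: "finite E" using E finite_K_edges finite_subset by blast
  have "measure_pmf.prob (random_orientation E) {A. D \<inter> A = {}} =
    measure_pmf.prob (Pi_pmf E undefined (\<lambda>e. pmf_of_set {a. undirected a = e})) (Pi E (\<lambda>_. - D))"
    by (auto simp: random_orientation_def intro!: arg_cong2[where f = measure])
  also have "\<dots> = (\<Prod>e\<in>E. measure_pmf.prob (pmf_of_set {a. undirected a = e}) (- D))"
    using fin by (rule measure_Pi_pmf_Pi)
  also have "\<dots> = (\<Prod>e\<in>E. if e \<in> undirected ` D then 1/2 else 1)"
    using E D by (intro prod.cong refl prob_orientation_avoids) auto
  also have "\<dots> = (1/2) ^ card (E \<inter> undirected ` D)"
    using fin by (simp add: prod.If_cases)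
  finally show ?thesis .
qed

lemma q'_eq_power:
  assumes D: "oriented_edges n l D" and p: "0 \<le> p" "p \<le> 1"
  shows "q' D n p = (1 - p / 2) ^ l"
proof -
  let ?F = "undirected ` D"
  let ?P = "Pi_pmf (K_edges n) False (\<lambda>_. bernoulli_pmf p)"
  have inj: "inj_on undirected D" and sub: "?F \<subseteq> K_edges n" and l: "card ?F = l"
    using D by (auto simp: oriented_edges_def card_image)
  have "q' D n p = measure_pmf.expectation ?P
      (\<lambda>present. measure_pmf.prob (random_orientation {e \<in> K_edges n. present e}) {A. D \<inter> A = {}})"
    by (simp add: q'_def dGnp_def Gnp_def bind_map_pmf measure_bind_pmf_expectation)
  also have "\<dots> = measure_pmf.expectation ?P
      (\<lambda>present. \<Prod>e\<in>K_edges n. if present e \<and> e \<in> ?F then 1/2 else 1)"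
  proof (intro Bochner_Integration.integral_cong refl)
    fix present
    have "{e \<in> K_edges n. present e} \<inter> ?F = K_edges n \<inter> {e. present e \<and> e \<in> ?F}" by auto
    then show "measure_pmf.prob (random_orientation {e \<in> K_edges n. present e}) {A. D \<inter> A = {}} =
      (\<Prod>e\<in>K_edges n. if present e \<and> e \<in> ?F then 1/2 else 1)"
      using finite_K_edges[of n]
      by (subst prob_random_orientation_avoids[OF _ inj]) (auto simp: prod.If_cases)
  qed
  also have "\<dots> = (\<Prod>e\<in>K_edges n. measure_pmf.expectation (bernoulli_pmf p)
      (\<lambda>b. if b \<and> e \<in> ?F then 1/2 else 1))"
    by (intro expectation_prod_Pi_pmf finite_K_edges)
       (auto intro!: integrable_measure_pmf_finite)
  also have "\<dots> = (\<Prod>e\<in>K_edges n. if e \<in> ?F then 1 - p / 2 else 1)"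
    using p by (intro prod.cong refl) (auto simp: field_simps)
  also have "\<dots> = (1 - p / 2) ^ card (K_edges n \<inter> ?F)"
    using finite_K_edges by (simp add: prod.If_cases)
  also have "K_edges n \<inter> ?F = ?F" using sub by auto
  finally show ?thesis using l by simp
qed

lemma q_eq_std_avoid_weight:
  assumes D: "oriented_edges n l D" and m: "m \<le> n choose 2"
  shows "q D n m = std_avoid_weight (n choose 2) m l / ((n choose 2) choose m)"
proof -
  let ?F = "undirected ` D" and ?M = "{E. E \<subseteq> K_edges n \<and> card E = m}"
  have inj: "inj_on undirected D" and sub: "?F \<subseteq> K_edges n" and l: "card ?F = l"
    using D by (auto simp: oriented_edges_def card_image)
  have card_M: "card ?M = (n choose 2) choose m"
    using n_subsets[OF finite_K_edges] by (simp add: card_K_edges)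
  then have "card ?M \<noteq> 0" using m by simp
  then have M: "?M \<noteq> {}" "finite ?M" by (metis card.empty, metis card.infinite)
  have "q D n m = (\<Sum>E\<in>?M. measure_pmf.prob (random_orientation E) {A. D \<inter> A = {}}) / card ?M"
    unfolding q_def dGnm_def Gnm_def measure_bind_pmf_expectation
    using M by (rule integral_pmf_of_set)
  also have "(\<Sum>E\<in>?M. measure_pmf.prob (random_orientation E) {A. D \<inter> A = {}}) =
      avoid_weight (K_edges n) m ?F"
    unfolding avoid_weight_def
    by (intro sum.cong refl prob_random_orientation_avoids[OF _ inj]) auto
  finally show ?thesis
    using finite_K_edges sub l card_M by (simp add: avoid_weight_eq_std card_K_edges)
qed

section \<open>Comparison with the binomial model\<close>

text \<open>Chebyshev's sum inequality for oppositely ordered functions on an arbitrary index set, by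
  summing the hypothesis over all pairs.\<close>
lemma chebyshev_sum_opposite:
  fixes f g :: "'a \<Rightarrow> real"
  assumes "\<And>x y. x \<in> M \<Longrightarrow> y \<in> M \<Longrightarrow> (f x - f y) * (g x - g y) \<le> 0"
  shows "card M * (\<Sum>x\<in>M. f x * g x) \<le> (\<Sum>x\<in>M. f x) * (\<Sum>x\<in>M. g x)"
proof -
  have "(\<Sum>x\<in>M. \<Sum>y\<in>M. (f x - f y) * (g x - g y)) \<le> 0"
    using assms by (intro sum_nonpos)
  also have "(\<Sum>x\<in>M. \<Sum>y\<in>M. (f x - f y) * (g x - g y)) =
    (\<Sum>x\<in>M. \<Sum>y\<in>M. f x * g x + f y * g y - f x * g y - g x * f y)"
    by (simp add: algebra_simps)
  also have "\<dots> =
    (\<Sum>x\<in>M. \<Sum>y\<in>M. f x * g x) + (\<Sum>x\<in>M. \<Sum>y\<in>M. f y * g y)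
     - (\<Sum>x\<in>M. \<Sum>y\<in>M. f x * g y) - (\<Sum>x\<in>M. \<Sum>y\<in>M. g x * f y)"
    by (simp only: sum.distrib sum_subtractf)
  also have "\<dots> = 2 * (card M * (\<Sum>x\<in>M. f x * g x)) - 2 * ((\<Sum>x\<in>M. f x) * (\<Sum>x\<in>M. g x))"
    by (simp add: sum_distrib_left[symmetric] sum_distrib_right[symmetric])
  finally show ?thesis by simp
qed

text \<open>The mean of \<open>card (E \<inter> F)\<close> over all \<open>m\<close>-sets is \<open>l * m / N\<close>, the mean of the hypergeometric
  distribution; here it is cleared of denominators.\<close>
lemma sum_card_Int:
  assumes "l \<le> N" "m \<le> N"
  shows "N * (\<Sum>E | E \<subseteq> {..<N} \<and> card E = m. real (card (E \<inter> {..<l}))) = real (l * m * (N choose m))"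
proof -
  let ?M = "{E. E \<subseteq> {..<N} \<and> card E = m}"
  have fin: "finite ?M" by (rule finite_subsets_of_card) simp
  have one: "real N * (\<Sum>E\<in>?M. of_bool (e \<in> E) * 1) = real (m * (N choose m))" if "e < N" for e
  proof -
    have "{E. E \<subseteq> {..<N} - {e} \<and> card E = m} = {E \<in> ?M. e \<notin> E}" by auto
    then have "card {E \<in> ?M. e \<notin> E} = (N - 1) choose m"
      using n_subsets[of "{..<N} - {e}" m] that by simp
    moreover have "card ?M = N choose m" by (simp add: n_subsets)
    moreover have "card ?M = card {E \<in> ?M. e \<in> E} + card {E \<in> ?M. e \<notin> E}"
      using fin by (subst card_Un_disjoint[symmetric]) (auto intro!: arg_cong[where f = card])
    ultimately have *: "real (card {E \<in> ?M. e \<in> E}) = real (N choose m) - real ((N - 1) choose m)"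
      by simp
    have "(\<Sum>E\<in>?M. of_bool (e \<in> E) * 1 :: real) = real (card {E \<in> ?M. e \<in> E})"
      using fin by (simp add: sum_of_bool_eq Int_def)
    then have "real N * (\<Sum>E\<in>?M. of_bool (e \<in> E) * 1) =
        real N * real (N choose m) - real (N * ((N - 1) choose m))"
      unfolding * by (simp add: right_diff_distrib)
    also have "real (N * ((N - 1) choose m)) = real ((N - m) * (N choose m))"
      by (simp only: binomial_absorb_comp)
    finally show ?thesis using assms by (simp add: of_nat_diff left_diff_distrib)
  qed
  have "(\<Sum>E\<in>?M. real (card (E \<inter> {..<l}))) = (\<Sum>e<l. \<Sum>E\<in>?M. of_bool (e \<in> E) * 1)"
    using sum_incidence[of "{..<l}" "\<lambda>_. 1" ?M] by simp
  then have "N * (\<Sum>E\<in>?M. real (card (E \<inter> {..<l}))) =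
      (\<Sum>e<l. real N * (\<Sum>E\<in>?M. of_bool (e \<in> E) * 1))"
    by (simp add: sum_distrib_left)
  also have "\<dots> = (\<Sum>e<l. real (m * (N choose m)))"
    using assms by (intro sum.cong refl one) auto
  finally show ?thesis by simp
qed

text \<open>This is \<open>\<pi>\<^sub>l \<ge> p\<close>: a weight that favours sets with few elements in \<open>F\<close> favours sets with many
  elements outside \<open>F\<close>.\<close>
lemma std_avoid_weight_Suc_le_density:
  assumes l: "l < N" and m: "m \<le> N"
  shows "std_avoid_weight N m (Suc l) \<le> std_avoid_weight N m l * (1 - m / N / 2)"
proof -
  let ?M = "{E. E \<subseteq> {..<N} \<and> card E = m}"
  let ?a = "std_avoid_weight N m"
  have C: "real (card ?M) = N choose m" "N choose m > 0" using m by (auto simp: n_subsets)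
  have "card ?M * (\<Sum>E\<in>?M. (1/2) ^ card (E \<inter> {..<l}) * real (card (E \<inter> {..<l}))) \<le>
      (\<Sum>E\<in>?M. (1/2) ^ card (E \<inter> {..<l})) * (\<Sum>E\<in>?M. real (card (E \<inter> {..<l})))"
  proof (rule chebyshev_sum_opposite)
    have *: "(1/2) ^ j - (1/2 :: real) ^ i \<le> 0" if "i \<le> j" for i j :: nat
      using that by (simp add: power_decreasing)
    show "((1/2) ^ card (E \<inter> {..<l}) - (1/2) ^ card (E' \<inter> {..<l})) *
          (real (card (E \<inter> {..<l})) - real (card (E' \<inter> {..<l}))) \<le> 0" for E E'
      using *[of "card (E \<inter> {..<l})" "card (E' \<inter> {..<l})"]
        *[of "card (E' \<inter> {..<l})" "card (E \<inter> {..<l})"]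
      by (cases "card (E \<inter> {..<l}) \<le> card (E' \<inter> {..<l})") (auto simp: mult_le_0_iff)
  qed
  then have "(N choose m) * (l * (?a (l - 1) - ?a l)) \<le> ?a l * (\<Sum>E\<in>?M. real (card (E \<inter> {..<l})))"
    unfolding C(1) std_avoid_weight_diff[OF less_imp_le[OF l]]
    unfolding std_avoid_weight_def avoid_weight_def .
  then have "N * ((N choose m) * (l * (?a (l - 1) - ?a l))) \<le>
      N * (?a l * (\<Sum>E\<in>?M. real (card (E \<inter> {..<l}))))"
    by (rule mult_left_mono) simp
  also have "\<dots> = ?a l * (N * (\<Sum>E\<in>?M. real (card (E \<inter> {..<l}))))"
    by (rule mult.left_commute)
  also have "\<dots> = (N choose m) * (?a l * l * m)"
    unfolding sum_card_Int[OF less_imp_le[OF l] m] by simp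
  finally have "(N choose m) * (N * (l * (?a (l - 1) - ?a l))) \<le> (N choose m) * (?a l * l * m)"
    by (simp add: mult_ac)
  then have "N * (l * (?a (l - 1) - ?a l)) \<le> ?a l * l * m"
    using C(2) by simp
  moreover have "N * (2 * (real N - real l) * (?a l - ?a (Suc l))) =
      N * (m * ?a l) - N * (l * (?a (l - 1) - ?a l))"
    unfolding right_diff_distrib[of "real N", symmetric] std_avoid_weight_recurrence[OF l, of m, symmetric] by simp
  ultimately have "(real N - real l) * (2 * N * (?a l - ?a (Suc l))) \<ge> (real N - real l) * (m * ?a l)"
    by (simp add: algebra_simps)
  then have "2 * N * (?a l - ?a (Suc l)) \<ge> m * ?a l"
    using l by (simp add: mult_le_cancel_left)
  then show ?thesis using l by (simp add: field_simps)
qed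

text \<open>Iterating \<open>\<pi>\<^sub>i \<ge> p\<close> over \<open>i < l\<close>.\<close>
lemma q_le_power:
  assumes D: "oriented_edges n l D" and l: "l \<le> n choose 2" and m: "m \<le> n choose 2"
    and p: "p = edge_density n m"
  shows "q D n m \<le> (1 - p / 2) ^ l"
proof -
  define N where "N = n choose 2"
  have "std_avoid_weight N m i \<le> (N choose m) * (1 - p / 2) ^ i" if "i \<le> N" for i
    using that
  proof (induction i)
    case (Suc i)
    have p2: "0 \<le> 1 - p / 2" using m by (auto simp: p edge_density_def divide_le_eq)
    have "std_avoid_weight N m (Suc i) \<le> std_avoid_weight N m i * (1 - p / 2)"
      using std_avoid_weight_Suc_le_density[of i N m] Suc.prems m by (simp add: p edge_density_def N_def)
    also have "\<dots> \<le> (N choose m) * (1 - p / 2) ^ i * (1 - p / 2)"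
      using Suc p2 by (intro mult_right_mono) auto
    finally show ?case by (simp add: mult_ac)
  qed (simp add: std_avoid_weight_0)
  from this[of l] show ?thesis
    using l m by (simp add: q_eq_std_avoid_weight[OF D m] N_def[symmetric] divide_le_eq mult.commute)
qed

section \<open>The conditional probability of the next edge\<close>

text \<open>This is \<open>\<pi>\<^sub>l\<close>: given that \<open>l\<close> directed edges are absent from the random directed graph, the
  conditional probability that a further edge belongs to the underlying undirected graph. It is solved
  for from the fact that the orientation of that edge is the prescribed one with probability \<open>1/2\<close>.\<close>
definition next_prob :: "nat \<Rightarrow> nat \<Rightarrow> nat \<Rightarrow> real" where
  "next_prob N m l = 2 * (1 - std_avoid_weight N m (Suc l) / std_avoid_weight N m l)"

lemma std_avoid_weight_Suc:
  assumes "m \<le> N"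
  shows "std_avoid_weight N m (Suc l) = std_avoid_weight N m l * (1 - next_prob N m l / 2)"
  using std_avoid_weight_pos[OF assms, of l] by (simp add: next_prob_def field_simps)

lemma std_avoid_weight_eq_prod:
  assumes "m \<le> N"
  shows "std_avoid_weight N m l = (N choose m) * (\<Prod>i<l. 1 - next_prob N m i / 2)"
  by (induction l) (simp_all add: std_avoid_weight_0 std_avoid_weight_Suc[OF assms])

lemma next_prob_bounds:
  assumes "l < N" "m \<le> N"
  shows "0 \<le> next_prob N m l" "next_prob N m l \<le> 1"
  using std_avoid_weight_Suc_le[OF assms(1), of m] std_avoid_weight_Suc_ge[of N m l] std_avoid_weight_pos[OF assms(2), of l]
  by (auto simp: next_prob_def field_simps)

lemma next_prob_0: "m \<le> N \<Longrightarrow> 0 < N \<Longrightarrow> next_prob N m 0 = m / N"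
  using std_avoid_weight_recurrence[of 0 N m] std_avoid_weight_pos[of m N 0]
  by (simp add: next_prob_def field_simps)

text \<open>The recurrence for the weights, divided by the weight itself. An edge that was present with
  probability \<open>x\<close> and is then found not to have the prescribed orientation is present with
  probability \<open>(x/2) / (1 - x/2) = x / (2 - x)\<close>.\<close>
lemma next_prob_Suc:
  assumes "Suc l < N" "m \<le> N"
  shows "(real N - Suc l) * next_prob N m (Suc l) =
    m - Suc l * (next_prob N m l / (2 - next_prob N m l))"
proof -
  let ?a = "std_avoid_weight N m" and ?\<pi> = "next_prob N m"
  have pos: "?a (Suc l) > 0" "2 - ?\<pi> l > 0"
    using std_avoid_weight_pos[OF assms(2)] next_prob_bounds[of l N m] assms by auto
  have forward: "2 * (?a (Suc l) - ?a (Suc (Suc l))) = ?a (Suc l) * ?\<pi> (Suc l)"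
    by (simp add: std_avoid_weight_Suc[OF assms(2), of "Suc l"] algebra_simps)
  have backward: "?a l - ?a (Suc l) = ?a (Suc l) * (?\<pi> l / (2 - ?\<pi> l))"
    using pos(2) by (simp add: std_avoid_weight_Suc[OF assms(2), of l] field_simps)
  have "(real N - Suc l) * (2 * (?a (Suc l) - ?a (Suc (Suc l)))) + Suc l * (?a l - ?a (Suc l)) = m * ?a (Suc l)"
    using std_avoid_weight_recurrence[OF assms(1), of m] by (simp add: algebra_simps)
  then have "?a (Suc l) * ((real N - Suc l) * ?\<pi> (Suc l) + Suc l * (?\<pi> l / (2 - ?\<pi> l))) = ?a (Suc l) * m"
    unfolding forward backward by (simp add: algebra_simps)
  then show ?thesis using pos(1) by simp
qed

text \<open>The function \<open>g\<close> of the recurrence; its fixed points \<open>0\<close> and \<open>1\<close> are the densities at which exposing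
  directed edges conveys no information.\<close>
definition tilt :: "real \<Rightarrow> real" where "tilt x = x / (2 - x)"

lemma tilt_bounds:
  assumes "0 \<le> x" "x \<le> 1"
  shows "0 \<le> tilt x" "tilt x \<le> 1"
  using assms by (simp_all add: tilt_def field_simps)

lemma tilt_lipschitz:
  assumes "0 \<le> x" "x \<le> 1" "0 \<le> y" "y \<le> 1"
  shows "\<bar>tilt x - tilt y\<bar> \<le> 2 * \<bar>x - y\<bar>"
proof -
  have "tilt x - tilt y = 2 * (x - y) / ((2 - x) * (2 - y))"
    using assms by (simp add: tilt_def field_simps)
  moreover have D: "1 * 1 \<le> (2 - x) * (2 - y)"
    using assms by (intro mult_mono) auto
  ultimately have "\<bar>tilt x - tilt y\<bar> = 2 * \<bar>x - y\<bar> / ((2 - x) * (2 - y))"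
    by (simp only: abs_divide abs_mult[of 2])
  also have "\<dots> \<le> 2 * \<bar>x - y\<bar> / 1"
    using D by (intro divide_left_mono) auto
  finally show ?thesis by simp
qed

text \<open>Both bounds come from \<open>(N - l) (\<pi>\<^sub>l - p) = l (p - g(\<pi>\<^sub>l\<^sub>-\<^sub>1))\<close>: the first only uses that \<open>p\<close> and the
  values of \<open>g\<close> lie in the unit interval, and the second inserts the first into the difference between
  \<open>g(\<pi>\<^sub>l\<^sub>-\<^sub>1)\<close> and \<open>g p\<close>.\<close>
lemma next_prob_deviation:
  assumes "l < N" "m \<le> N"
  defines "p \<equiv> m / N"
  shows "\<bar>next_prob N m l - p\<bar> \<le> l / (real N - l)"
    and "\<bar>N * (next_prob N m l - p) - l * (p - tilt p)\<bar> \<le> 3 * (real l)\<^sup>2 / (real N - l)"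
proof -
  let ?\<pi> = "next_prob N m"
  have p: "0 \<le> p" "p \<le> 1" using assms by (auto simp: p_def)
  have Np: "real N * p = m" using assms by (simp add: p_def)
  have step: "(real N - Suc i) * (?\<pi> (Suc i) - p) = Suc i * (p - tilt (?\<pi> i))" if "Suc i < N" for i
    using next_prob_Suc[OF that assms(2), folded tilt_def] Np by (simp add: algebra_simps)
  have first: "\<bar>?\<pi> i - p\<bar> \<le> i / (real N - i)" if "i < N" for i
  proof (cases i)
    case 0
    then show ?thesis using assms by (simp add: next_prob_0 p_def)
  next
    case (Suc j)
    have "\<bar>p - tilt (?\<pi> j)\<bar> \<le> 1"
      using tilt_bounds[OF next_prob_bounds[of j N m]] that Suc p assms(2) by auto
    then have le: "i * \<bar>p - tilt (?\<pi> j)\<bar> \<le> real i * 1" by (rule mult_left_mono) simp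
    have "\<bar>(real N - i) * (?\<pi> i - p)\<bar> = i * \<bar>p - tilt (?\<pi> j)\<bar>"
      using step[of j] that by (simp add: Suc abs_mult)
    also note le
    finally show ?thesis using that by (simp add: abs_mult pos_le_divide_eq mult.commute)
  qed
  show "\<bar>?\<pi> l - p\<bar> \<le> l / (real N - l)" by (rule first[OF assms(1)])
  show "\<bar>N * (?\<pi> l - p) - l * (p - tilt p)\<bar> \<le> 3 * (real l)\<^sup>2 / (real N - l)"
  proof (cases l)
    case 0
    then show ?thesis using assms by (simp add: next_prob_0 p_def)
  next
    case (Suc j)
    let ?d = "l / (real N - l)"
    have prev: "\<bar>?\<pi> j - p\<bar> \<le> ?d"
    proof -
      have "\<bar>?\<pi> j - p\<bar> \<le> j / (real N - j)" using first[of j] assms Suc by simp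
      also have "\<dots> \<le> ?d" using assms Suc by (intro frac_le) auto
      finally show ?thesis .
    qed
    have "N * (?\<pi> l - p) - l * (p - tilt p) = l * (?\<pi> l - p) - l * (tilt (?\<pi> j) - tilt p)"
      using step[of j] assms Suc by (simp add: algebra_simps)
    also have "\<bar>\<dots>\<bar> \<le> l * \<bar>?\<pi> l - p\<bar> + l * \<bar>tilt (?\<pi> j) - tilt p\<bar>"
      by (rule order_trans[OF abs_triangle_ineq4]) (simp add: abs_mult)
    also have "\<dots> \<le> l * ?d + l * (2 * ?d)"
    proof (intro add_mono mult_left_mono)
      have "\<bar>tilt (?\<pi> j) - tilt p\<bar> \<le> 2 * \<bar>?\<pi> j - p\<bar>"
        using next_prob_bounds[of j N m] assms Suc p by (intro tilt_lipschitz) auto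
      also have "\<dots> \<le> 2 * ?d" using prev by simp
      finally show "\<bar>tilt (?\<pi> j) - tilt p\<bar> \<le> 2 * ?d" .
    qed (use first[OF assms(1)] in auto)
    also have "\<dots> = 3 * (real l)\<^sup>2 / (real N - l)" by (simp add: power2_eq_square)
    finally show ?thesis .
  qed
qed

section \<open>Asymptotics\<close>

lemma choose_two_real: "real (n choose 2) = real n * (real n - 1) / 2"
proof -
  have "even (n * (n - 1))" by auto
  then have "real (n choose 2) = real (n * (n - 1)) / 2"
    unfolding choose_two by (simp add: real_of_nat_div)
  then show ?thesis by (cases n) (simp_all add: algebra_simps)
qed

text \<open>Since \<open>l \<le> N / 4\<close>, the deviation is at most \<open>2 l / N \<le> 1/2\<close> and the logarithm can be linearised.
  The constant \<open>14\<close> is \<open>8\<close> from the quadratic term of the logarithm plus \<open>6\<close> from the second-order error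
  of the conditional probability.\<close>
lemma ln_factor_bound:
  assumes "4 * l \<le> N" "0 < N" "m \<le> N"
  defines "p \<equiv> m / N"
  shows "\<bar>ln ((1 - next_prob N m l / 2) / (1 - p / 2)) + l * (p * (1 - p) / (2 - p)\<^sup>2) / N\<bar>
    \<le> 14 * (l / N)\<^sup>2"
proof -
  let ?r = "l / N"
  define d where "d = next_prob N m l - p"
  have lN: "l < N" using assms by auto
  have p: "0 \<le> p" "p \<le> 1" using assms by (auto simp: p_def)
  have half: "real N - l \<ge> N / 2" "real N - l > 0" using assms by linarith+
  have "\<bar>d\<bar> \<le> l / (real N - l)"
    unfolding d_def p_def by (rule next_prob_deviation(1)[OF lN assms(3)])
  also have "\<dots> \<le> l / (N / 2)" using half assms by (intro divide_left_mono) auto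
  finally have d1: "\<bar>d\<bar> \<le> 2 * ?r" by (simp add: mult.commute)
  have "N * \<bar>d - ?r * (p - tilt p)\<bar> = \<bar>N * d - l * (p - tilt p)\<bar>"
    using assms by (simp add: abs_mult[of "real N", symmetric, simplified] right_diff_distrib)
  also have "\<dots> \<le> 3 * (real l)\<^sup>2 / (real N - l)"
    unfolding d_def p_def by (rule next_prob_deviation(2)[OF lN assms(3)])
  also have "\<dots> \<le> 3 * (real l)\<^sup>2 / (N / 2)" using half assms by (intro divide_left_mono) auto
  also have "\<dots> = N * (6 * ?r\<^sup>2)" using assms by (simp add: power2_eq_square)
  finally have d2: "\<bar>d - ?r * (p - tilt p)\<bar> \<le> 6 * ?r\<^sup>2" using assms by simp
  \<comment> \<open>The factor equals \<open>1 + x\<close>.\<close>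
  define x where "x = - d / (2 - p)"
  have x_le: "\<bar>x\<bar> \<le> \<bar>d\<bar>"
    using p by (simp add: x_def abs_divide divide_le_eq mult_le_cancel_left1)
  have "?r \<le> 1 / 4" using assms by (simp add: field_simps)
  then have "\<bar>x\<bar> \<le> 1 / 2" using x_le d1 by linarith
  then have ln_x: "\<bar>ln (1 + x) - x\<bar> \<le> 2 * x\<^sup>2" by (rule abs_ln_one_plus_x_minus_x_bound)
  have "x\<^sup>2 \<le> (2 * ?r)\<^sup>2" using x_le d1 by (intro power2_le_iff_abs_le[THEN iffD2]) auto
  then have quad: "2 * x\<^sup>2 \<le> 8 * ?r\<^sup>2" by (simp add: power_mult_distrib power_divide)
  have "p - tilt p = p * (1 - p) / (2 - p)" using p by (simp add: tilt_def field_simps)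
  then have "x + ?r * (p * (1 - p) / (2 - p)\<^sup>2) = - (d - ?r * (p - tilt p)) / (2 - p)"
    using p by (simp add: x_def power2_eq_square add_divide_distrib diff_divide_distrib)
  then have "\<bar>x + ?r * (p * (1 - p) / (2 - p)\<^sup>2)\<bar> = \<bar>d - ?r * (p - tilt p)\<bar> / (2 - p)"
    using p by (simp add: abs_divide abs_minus_commute)
  also have "\<dots> \<le> \<bar>d - ?r * (p - tilt p)\<bar>"
    using p by (simp add: divide_le_eq mult_le_cancel_left1)
  finally have lin: "\<bar>x + ?r * (p * (1 - p) / (2 - p)\<^sup>2)\<bar> \<le> 6 * ?r\<^sup>2" using d2 by linarith
  have "\<bar>ln (1 + x) + ?r * (p * (1 - p) / (2 - p)\<^sup>2)\<bar> \<le>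
      \<bar>ln (1 + x) - x\<bar> + \<bar>x + ?r * (p * (1 - p) / (2 - p)\<^sup>2)\<bar>"
    using abs_triangle_ineq[of "ln (1 + x) - x" "x + ?r * (p * (1 - p) / (2 - p)\<^sup>2)"] by simp
  also have "\<dots> \<le> 8 * ?r\<^sup>2 + 6 * ?r\<^sup>2"
    by (intro add_mono order_trans[OF ln_x quad] lin)
  finally have "\<bar>ln (1 + x) + ?r * (p * (1 - p) / (2 - p)\<^sup>2)\<bar> \<le> 14 * ?r\<^sup>2"
    by (simp only: distrib_right[symmetric]) simp
  moreover have "(1 - next_prob N m l / 2) / (1 - p / 2) = 1 + x"
    using p by (simp add: x_def d_def field_simps)
  ultimately show ?thesis
    by (simp only: times_divide_eq_left)
qed

text \<open>The first error term collects the errors of the \<open>l\<close> factors. The second is the price of replacing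
  \<open>l (l - 1) / (n (n - 1))\<close>, which comes from \<open>(\<Sum>i<l. i) / N\<close>, by \<open>(l / n)\<^sup>2\<close>. Both are written in terms of
  \<open>l / n\<close>, the quantity that stays bounded.\<close>
lemma ln_q_bound:
  assumes D: "oriented_edges n l D" and n: "2 \<le> n" and m: "m \<le> n choose 2"
    and l: "4 * l \<le> n choose 2" and p: "p = edge_density n m"
  defines "e \<equiv> (real l / n)\<^sup>2 * (p * (1 - p) / (2 - p)\<^sup>2)"
  shows "q D n m / ((1 - p / 2) ^ l * exp (- e)) > 0"
    and "\<bar>ln (q D n m / ((1 - p / 2) ^ l * exp (- e)))\<bar> \<le>
      56 * (real l / n) ^ 3 * n / (real n - 1)\<^sup>2 + (real l / n) * (real l / n + 1) / (real n - 1)"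
proof -
  define N where "N = n choose 2"
  define \<kappa> where "\<kappa> = p * (1 - p) / (2 - p)\<^sup>2"
  define f where "f i = (1 - next_prob N m i / 2) / (1 - p / 2)" for i
  have N0: "0 < N" using n by (simp add: N_def)
  have N_eq: "real N = n * (real n - 1) / 2"
    unfolding N_def by (rule choose_two_real)
  have p_eq: "p = m / N" by (simp add: p edge_density_def N_def)
  have p01: "0 \<le> p" "p \<le> 1" using m N0 by (auto simp: p_eq N_def)
  have m': "m \<le> N" and l': "4 * l \<le> N" using m l by (auto simp: N_def)
  have f_pos: "f i > 0" if "i < l" for i
    using next_prob_bounds[of i N m] that l' m' p01 by (simp add: f_def)
  have q_prod: "q D n m = (\<Prod>i<l. 1 - next_prob N m i / 2)"
    using m' by (simp add: q_eq_std_avoid_weight[OF D m] std_avoid_weight_eq_prod flip: N_def)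
  have exp_out: "P / (A * exp (- e)) = P / A * exp e" for P A :: real
    by (simp add: exp_minus field_simps)
  have ratio: "q D n m / ((1 - p / 2) ^ l * exp (- e)) = (\<Prod>i<l. f i) * exp e"
    unfolding q_prod exp_out by (simp only: f_def prod_dividef prod_constant card_lessThan)
  have prod_pos: "(\<Prod>i<l. f i) > 0" using f_pos by (intro prod_pos) auto
  then show "q D n m / ((1 - p / 2) ^ l * exp (- e)) > 0" unfolding ratio by simp
  have \<kappa>: "0 \<le> \<kappa>" "\<kappa> \<le> 1"
  proof -
    show "0 \<le> \<kappa>" using p01 by (simp add: \<kappa>_def)
    have "p * (1 - p) \<le> 1 * 1" using p01 by (intro mult_mono) auto
    also have "1 * 1 \<le> (2 - p)\<^sup>2" unfolding power2_eq_square using p01 by (intro mult_mono) auto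
    finally show "\<kappa> \<le> 1" using p01 by (simp add: \<kappa>_def)
  qed
  have sum_i: "(\<Sum>i<l. real i) = l * (real l - 1) / 2" by (induction l) (simp_all add: field_simps)
  have "\<bar>(\<Sum>i<l. ln (f i)) + (\<Sum>i<l. i * \<kappa> / N)\<bar> \<le> (\<Sum>i<l. \<bar>ln (f i) + i * \<kappa> / N\<bar>)"
    unfolding sum.distrib[symmetric] by (rule sum_abs)
  also have "\<dots> \<le> (\<Sum>i<l. 14 * (l / N)\<^sup>2)"
  proof (rule sum_mono)
    fix i assume i: "i \<in> {..<l}"
    then have "\<bar>ln (f i) + i * \<kappa> / N\<bar> \<le> 14 * (i / N)\<^sup>2"
      using ln_factor_bound[of i N m] l' N0 m' by (simp add: f_def \<kappa>_def p_eq)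
    also have "\<dots> \<le> 14 * (l / N)\<^sup>2"
      using i by (intro mult_left_mono power_mono divide_right_mono) auto
    finally show "\<bar>ln (f i) + i * \<kappa> / N\<bar> \<le> 14 * (l / N)\<^sup>2" .
  qed
  also have "\<dots> = 56 * (real l / n) ^ 3 * n / (real n - 1)\<^sup>2"
    using n by (simp add: N_eq power2_eq_square power3_eq_cube field_simps)
  finally have main: "\<bar>(\<Sum>i<l. ln (f i)) + (\<Sum>i<l. i * \<kappa> / N)\<bar> \<le>
      56 * (real l / n) ^ 3 * n / (real n - 1)\<^sup>2" .
  have "(\<Sum>i<l. i * \<kappa> / N) = l * (real l - 1) / 2 * \<kappa> / N"
    unfolding sum_i[symmetric] by (simp add: sum_distrib_right sum_divide_distrib)
  then have "e - (\<Sum>i<l. i * \<kappa> / N) =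
      (real l / n)\<^sup>2 * \<kappa> - l * (real l - 1) / 2 * \<kappa> / (n * (real n - 1) / 2)"
    by (simp only: e_def \<kappa>_def[symmetric] N_eq)
  also have "\<dots> = \<kappa> * ((real l / n) * (1 - real l / n) / (real n - 1))"
    using n by (simp add: power2_eq_square field_simps)
  also have "\<bar>\<dots>\<bar> \<le> 1 * ((real l / n) * (real l / n + 1) / (real n - 1))"
    unfolding abs_mult abs_divide using \<kappa> n
    by (intro mult_mono divide_mono) (auto simp: abs_le_iff)
  finally have rest: "\<bar>e - (\<Sum>i<l. i * \<kappa> / N)\<bar> \<le> (real l / n) * (real l / n + 1) / (real n - 1)"
    by simp
  have ln_prod_f: "ln (\<Prod>i<l. f i) = (\<Sum>i<l. ln (f i))"
    by (rule ln_prod, simp, metis f_pos lessThan_iff less_irrefl)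
  have "ln (q D n m / ((1 - p / 2) ^ l * exp (- e))) = (\<Sum>i<l. ln (f i)) + e"
    unfolding ratio ln_prod_f[symmetric] using ln_mult_pos[OF prod_pos, of "exp e"] by simp
  then show "\<bar>ln (q D n m / ((1 - p / 2) ^ l * exp (- e)))\<bar> \<le>
      56 * (real l / n) ^ 3 * n / (real n - 1)\<^sup>2 + (real l / n) * (real l / n + 1) / (real n - 1)"
    using main rest by linarith
qed

theorem lemma3p2:
  shows "(\<forall>(l :: nat \<Rightarrow> nat) (m :: nat \<Rightarrow> nat) (D :: nat \<Rightarrow> (nat \<times> nat) set) (p :: nat \<Rightarrow> real).
            (\<lambda>n. real (l n)) \<in> O(\<lambda>n. real n) \<longrightarrow>
            (\<forall>n. l n \<le> n choose 2) \<longrightarrow>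
            (\<forall>n. m n \<le> n choose 2) \<longrightarrow>
            (\<forall>n. p n = edge_density n (m n)) \<longrightarrow>
            (\<forall>n. oriented_edges n (l n) (D n)) \<longrightarrow>
            (\<lambda>n. q (D n) n (m n) /
                  ((1 - p n / 2) ^ l n *
                   exp (- ((real (l n) / real n)\<^sup>2 * (p n * (1 - p n) / (2 - p n)\<^sup>2)))))
              \<longlonglongrightarrow> 1)
       \<and> (\<forall>(n :: nat) (l :: nat) (m :: nat) (D :: (nat \<times> nat) set) (p :: real).
            2 \<le> n \<longrightarrow> l \<le> n choose 2 \<longrightarrow> m \<le> n choose 2 \<longrightarrow>
            p = edge_density n m \<longrightarrow>
            oriented_edges n l D \<longrightarrow>
            q D n m \<le> q' D n p \<and> q' D n p = (1 - p / 2) ^ l)"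
proof (intro conjI allI impI)
  fix l m :: "nat \<Rightarrow> nat" and D :: "nat \<Rightarrow> (nat \<times> nat) set" and p :: "nat \<Rightarrow> real"
  assume lO: "(\<lambda>n. real (l n)) \<in> O(\<lambda>n. real n)"
    and m: "\<forall>n. m n \<le> n choose 2"
    and p: "\<forall>n. p n = edge_density n (m n)"
    and D: "\<forall>n. oriented_edges n (l n) (D n)"
  let ?R = "\<lambda>n. q (D n) n (m n) / ((1 - p n / 2) ^ l n *
      exp (- ((real (l n) / real n)\<^sup>2 * (p n * (1 - p n) / (2 - p n)\<^sup>2))))"
  obtain C where C: "C > 0" "eventually (\<lambda>n. norm (real (l n)) \<le> C * norm (real n)) at_top"
    using lO by (auto elim: landau_o.bigE)
  \<comment> \<open>For these \<open>n\<close> also \<open>4 * l n \<le> 4 * C * n \<le> n * (n - 1) / 2\<close>, as the estimate of the logarithm requires.\<close>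
  have "eventually (\<lambda>n. real n \<ge> 8 * C + 1) at_top" by real_asymp
  then have ev: "eventually (\<lambda>n. ?R n > 0 \<and>
      norm (ln (?R n)) \<le> 56 * C ^ 3 * n / (real n - 1)\<^sup>2 + C * (C + 1) / (real n - 1)) at_top"
    using C(2) eventually_ge_at_top[of 2]
  proof eventually_elim
    case (elim n)
    have ratio: "real (l n) / n \<le> C" using elim by (simp add: field_simps)
    have "real (4 * l n) \<le> real n * (8 * C) / 2" using elim by (simp add: field_simps)
    also have "\<dots> \<le> real n * (real n - 1) / 2"
      using elim by (intro divide_right_mono mult_left_mono) auto
    also have "\<dots> = real (n choose 2)" by (rule choose_two_real[symmetric])
    finally have l4: "4 * l n \<le> n choose 2" by (simp only: of_nat_le_iff)
    note bound = ln_q_bound[OF D[rule_format] elim(3) m[rule_format] l4 p[rule_format]]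
    have "56 * (real (l n) / n) ^ 3 * n / (real n - 1)\<^sup>2 + (real (l n) / n) * (real (l n) / n + 1) / (real n - 1)
        \<le> 56 * C ^ 3 * n / (real n - 1)\<^sup>2 + C * (C + 1) / (real n - 1)"
      using ratio elim C(1)
      by (intro add_mono divide_right_mono mult_right_mono mult_left_mono power_mono mult_mono) auto
    then show ?case using bound by simp
  qed
  have "eventually (\<lambda>n. norm (ln (?R n)) \<le>
      56 * C ^ 3 * n / (real n - 1)\<^sup>2 + C * (C + 1) / (real n - 1)) at_top"
    using ev by (rule eventually_mono) (rule conjunct2)
  moreover have "(\<lambda>n. 56 * C ^ 3 * n / (real n - 1)\<^sup>2 + C * (C + 1) / (real n - 1)) \<longlonglongrightarrow> 0"
    by real_asymp
  ultimately have "(\<lambda>n. ln (?R n)) \<longlonglongrightarrow> 0"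
    by (rule Lim_null_comparison)
  then have "(\<lambda>n. exp (ln (?R n))) \<longlonglongrightarrow> exp 0" by (rule tendsto_exp)
  moreover have "eventually (\<lambda>n. exp (ln (?R n)) = ?R n) at_top"
    using ev by eventually_elim (simp only: exp_ln)
  ultimately show "?R \<longlonglongrightarrow> 1" by (auto elim: Lim_transform_eventually)
next
  fix n l m :: nat and D :: "(nat \<times> nat) set" and p :: real
  assume *: "2 \<le> n" "l \<le> n choose 2" "m \<le> n choose 2" "p = edge_density n m" "oriented_edges n l D"
  have "0 \<le> p" "p \<le> 1" using * by (auto simp: edge_density_def divide_le_eq)
  then show "q' D n p = (1 - p / 2) ^ l" using * by (intro q'_eq_power)
  then show "q D n m \<le> q' D n p" using * by (simp add: q_le_power)
qed

end
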